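(* Let $S:\mathbb{R}\rightarrow\mathbb{R}$ be locally bounded and sublinear (in particular, $S$ may be Baire/measurable and sublinear), with $S(0)=0$. Suppose that (i) $S$ satisfies the weak Heiberg-Seneta condition $(WHS)$, and (ii) $\mathbb{A}$ is a dense additive subgroup of $\mathbb{R}$ with $S|\mathbb{A}$ $\mathbb{N}$-homogeneous. Then both $S|\mathbb{R}_{+}$ and $S|\mathbb{R}_{-}$ are linear: for all $t\ge 0$, $$S(t)=\beta_{S}t\quad\text{and}\quad S(-t)=-\alpha_{S}t.$$ In particular, if $S$ is additive, then $S(t)=\beta_{S}t$ for all $t\in\mathbb{R}$.
   Context: A function $S:\mathbb{R}\to\mathbb{R}$ is subadditive if $S(x+y)\le S(x)+S(y)$ for all $x,y\in\mathbb{R}$; it is additive if equality always holds. $S$ is sublinear if it is subadditive and $S(nx)=nS(x)$ for all $x\in\mathbb{R}$ and $n=0,1,2,\dots$. For $\mathbb{A}\subseteq\mathbb{R}$ an additive subgroup, $S|\mathbb{A}$ is $\mathbb{N}$-homogeneous if $S(na)=nS(a)$ for all $a\in\mathbb{A}$ and $n=0,1,2,\dots$. Locally bounded means bounded on some neighbourhood of each point. Baire/measurable means that $S$ has the Baire property or is (Lebesgue) measurable. $\mathbb{R}_{+}=[0,\infty)$, $\mathbb{R}_{-}=(-\infty,0]$; a function on $D\subseteq\mathbb{R}$ is linear if it has the form $x\mapsto cx$ on $D$ for some $c\in\mathbb{R}$. For $S$ locally bounded and subadditive, $$\beta_{S}:=\inf_{t>0}\frac{S(t)}{t},\qquad \alpha_{S}:=\sup_{z<0}\frac{S(z)}{z}$$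 (both are finite). Locally Steinhaus-Weil sets: a set $\Sigma\subseteq\mathbb{R}$ is locally Steinhaus-Weil (SW) if for all $x,y\in\Sigma$ and all sufficiently small $\delta>0$, writing $\Sigma_{z}^{\delta}:=\Sigma\cap(z-\delta,z+\delta)$ for $z=x,y$, the point $x+y$ is interior to $\Sigma_{x}^{\delta}+\Sigma_{y}^{\delta}$ and the point $x-y$ is interior to $\Sigma_{x}^{\delta}-\Sigma_{y}^{\delta}$. Condition $(WHS)$: there is a locally SW set $\Sigma\subseteq(0,\infty)$ accumulating at $0$ (i.e. $0$ is an accumulation point of $\Sigma$) such that $$\gamma_{S}^{\Sigma}:=\limsup_{t\downarrow 0,\ t\in\Sigma}\frac{S(t)}{t}<\infty.$$ *)

theory Defs
  imports "HOL-Analysis.Analysis"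
begin

definition subadditive_fun :: "(real \<Rightarrow> real) \<Rightarrow> bool" where
  "subadditive_fun S \<longleftrightarrow> (\<forall>x y. S (x + y) \<le> S x + S y)"

definition nat_homogeneous_on :: "real set \<Rightarrow> (real \<Rightarrow> real) \<Rightarrow> bool" where
  "nat_homogeneous_on A S \<longleftrightarrow> (\<forall>a\<in>A. \<forall>n::nat. S (of_nat n * a) = of_nat n * S a)"

(* Only homogeneity over the naturals is required, not over all positive reals. *)
definition sublinear_fun :: "(real \<Rightarrow> real) \<Rightarrow> bool" where
  "sublinear_fun S \<longleftrightarrow> subadditive_fun S \<and> nat_homogeneous_on UNIV S"

definition linear_fun_on :: "real set \<Rightarrow> (real \<Rightarrow> real) \<Rightarrow> bool" where
  "linear_fun_on D S \<longleftrightarrow> (\<exists>c. \<forall>x\<in>D. S x = c * x)"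

definition additive_subgroup_real :: "real set \<Rightarrow> bool" where
  "additive_subgroup_real A \<longleftrightarrow>
     0 \<in> A \<and> (\<forall>x\<in>A. \<forall>y\<in>A. x + y \<in> A) \<and> (\<forall>x\<in>A. - x \<in> A)"

definition locally_bounded_fun :: "(real \<Rightarrow> real) \<Rightarrow> bool" where
  "locally_bounded_fun S \<longleftrightarrow> (\<forall>x. \<exists>U. open U \<and> x \<in> U \<and> bounded (S ` U))"

definition meagre_set :: "real set \<Rightarrow> bool" where
  "meagre_set M \<longleftrightarrow>
     (\<exists>N :: nat \<Rightarrow> real set. (\<forall>n. interior (closure (N n)) = {}) \<and> M \<subseteq> (\<Union>n. N n))"

definition baire_property_set :: "real set \<Rightarrow> bool" where
  "baire_property_set B \<longleftrightarrow> (\<exists>U. open U \<and> meagre_set (sym_diff B U))"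

definition baire_property_fun :: "(real \<Rightarrow> real) \<Rightarrow> bool" where
  "baire_property_fun S \<longleftrightarrow> (\<forall>V. open V \<longrightarrow> baire_property_set (S -` V))"

(* For locally bounded subadditive S on the whole line the two sets below are bounded
   (below resp. above), so the conditionally complete Inf and Sup of the reals are the
   true infimum and supremum. *)
definition beta_coeff :: "(real \<Rightarrow> real) \<Rightarrow> real" where
  "beta_coeff S = (INF t\<in>{0<..}. S t / t)"

definition alpha_coeff :: "(real \<Rightarrow> real) \<Rightarrow> real" where
  "alpha_coeff S = (SUP z\<in>{..<0}. S z / z)"

definition local_part :: "real set \<Rightarrow> real \<Rightarrow> real \<Rightarrow> real set" where
  "local_part \<Sigma> \<delta> z = \<Sigma> \<inter> {z - \<delta><..<z + \<delta>}"

(* The sum and difference below are algebraic (elementwise), hence the explicit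
   comprehensions: infix minus on sets would be set difference. *)
definition locally_steinhaus_weil :: "real set \<Rightarrow> bool" where
  "locally_steinhaus_weil \<Sigma> \<longleftrightarrow>
     (\<forall>x\<in>\<Sigma>. \<forall>y\<in>\<Sigma>. \<forall>\<^sub>F \<delta> in at_right 0.
        x + y \<in> interior {a + b | a b. a \<in> local_part \<Sigma> \<delta> x \<and> b \<in> local_part \<Sigma> \<delta> y} \<and>
        x - y \<in> interior {a - b | a b. a \<in> local_part \<Sigma> \<delta> x \<and> b \<in> local_part \<Sigma> \<delta> y})"

definition gamma_coeff :: "real set \<Rightarrow> (real \<Rightarrow> real) \<Rightarrow> ereal" where
  "gamma_coeff \<Sigma> S = Limsup (at 0 within (\<Sigma> \<inter> {0<..})) (\<lambda>t. ereal (S t / t))"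

definition weak_heiberg_seneta :: "(real \<Rightarrow> real) \<Rightarrow> bool" where
  "weak_heiberg_seneta S \<longleftrightarrow>
     (\<exists>\<Sigma>. \<Sigma> \<subseteq> {0<..} \<and> locally_steinhaus_weil \<Sigma> \<and> 0 islimpt \<Sigma> \<and> gamma_coeff \<Sigma> S < \<infinity>)"

end

theory Submission
  imports Defs
begin

text \<open>
  The Heiberg-Seneta bound \<open>S t \<le> C t\<close> on \<open>\<Sigma>\<close> near \<open>0\<close> passes by subadditivity to
  \<open>\<Sigma> + \<Sigma>\<close>, which contains an interval by the Steinhaus-Weil property. A subadditive function
  bounded above on one interval is so near \<open>0\<close>; scaling by \<open>n\<close> then forces \<open>S h \<rightarrow> 0\<close> as
  \<open>h \<rightarrow> 0\<close>, so \<open>S\<close> is continuous, and homogeneity extends from the nonnegative rationals to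
  the nonnegative reals.
\<close>

text \<open>Since \<open>h = (z + h) + (- z)\<close>, subadditivity carries a bound near
  \<open>z\<close> to one near \<open>0\<close>, at the cost of the constant
  \<open>S (- z)\<close>.\<close>

lemma subadditive_bounded_above_near_0:
  assumes sub: "subadditive_fun S" and "open U" "z \<in> U" and le: "\<And>u. u \<in> U \<Longrightarrow> S u \<le> M"
  obtains r K where "r > 0" "\<And>h. \<bar>h\<bar> < r \<Longrightarrow> S h \<le> K"
proof -
  obtain r where "r > 0" and r: "ball z r \<subseteq> U"
    using \<open>open U\<close> \<open>z \<in> U\<close> open_contains_ball by blast
  have "S h \<le> M + S (- z)" if "\<bar>h\<bar> < r" for h
  proof -
    have "z + h \<in> U"
      using r that by (auto simp: dist_real_def)
    moreover have "S ((z + h) + (- z)) \<le> S (z + h) + S (- z)"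
      using sub unfolding subadditive_fun_def by blast
    ultimately show ?thesis using le[of "z + h"] by simp
  qed
  with \<open>r > 0\<close> show ?thesis by (rule that)
qed

lemma sublinear_scale:
  assumes "sublinear_fun S"
  shows "S (real n * x) = real n * S x"
  using assms by (simp add: sublinear_fun_def nat_homogeneous_on_def)

text \<open>If \<open>n * h\<close> stays within \<open>r\<close> of \<open>0\<close>, then
  \<open>n * S h \<le> K\<close>, so \<open>S h\<close> is at most \<open>K / n\<close>, which is
  arbitrarily small.\<close>

lemma sublinear_continuous:
  assumes sl: "sublinear_fun S" and "r > 0" and le: "\<And>h. \<bar>h\<bar> < r \<Longrightarrow> S h \<le> K"
  shows "continuous_on UNIV S"
proof -
  have sub: "S (x + y) \<le> S x + S y" for x y
    using sl by (simp add: sublinear_fun_def subadditive_fun_def)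
  show ?thesis
    unfolding continuous_on_iff
  proof (intro ballI allI impI)
    fix x e :: real
    assume "e > 0"
    \<comment> \<open>This choice gives \<open>K / n < e\<close>; the maximum with \<open>0\<close>
      makes \<open>n\<close> positive, so that \<open>r / n\<close> is a valid radius.\<close>
    obtain n where n: "K / e < real n" "n > 0"
      using reals_Archimedean2[of "max 0 (K / e)"] by auto
    have small: "S h < e" if "\<bar>h\<bar> < r / real n" for h
    proof -
      have "\<bar>real n * h\<bar> < r"
        using that n by (simp add: abs_mult field_simps)
      then have "real n * S h \<le> K"
        using le sublinear_scale[OF sl] by metis
      also have "K < real n * e"
        using n \<open>e > 0\<close> by (simp add: field_simps)
      finally show ?thesis using n by simp
    qed
    \<comment> \<open>An upper bound controls both signs: \<open>S y - S x \<le> S (y - x)\<close>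
      and \<open>S x - S y \<le> S (x - y)\<close>.\<close>
    have "dist (S y) (S x) < e" if "dist y x < r / real n" for y
      using small[of "y - x"] small[of "x - y"] sub[of x "y - x"] sub[of y "x - y"] that
      by (simp add: dist_real_def abs_minus_commute abs_less_iff)
    then show "\<exists>d>0. \<forall>y\<in>UNIV. dist y x < d \<longrightarrow> dist (S y) (S x) < e"
      using \<open>r > 0\<close> n by (intro exI[of _ "r / real n"]) auto
  qed
qed

text \<open>Clearing denominators settles rational factors, and continuity together with density of
  the rationals settles the rest.\<close>

lemma continuous_sublinear_homogeneous:
  assumes sl: "sublinear_fun S" and cont: "continuous_on UNIV S" and "t \<ge> 0"
  shows "S (t * x) = t * S x"
proof -
  \<comment> \<open>The absolute value makes the identity meaningful for every rational, so the
    density of \<open>\<rat>\<close> in the whole line applies directly.\<close>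
  have rat: "S (\<bar>q\<bar> * x) - \<bar>q\<bar> * S x = 0" if "q \<in> \<rat>" for q
  proof -
    obtain m n :: nat where "n \<noteq> 0" and "\<bar>q\<bar> = real m / real n"
      using \<open>q \<in> \<rat>\<close> by (rule Rats_abs_nat_div_natE)
    then have m: "real m = real n * \<bar>q\<bar>" by simp
    have "real n * S (\<bar>q\<bar> * x) = S (real m * x)"
      by (simp add: m mult.assoc sublinear_scale[OF sl])
    also have "\<dots> = real m * S x"
      by (rule sublinear_scale[OF sl])
    finally show ?thesis using \<open>n \<noteq> 0\<close> by (simp add: m)
  qed
  have "continuous_on UNIV (\<lambda>q. S (\<bar>q\<bar> * x) - \<bar>q\<bar> * S x)"
    by (intro continuous_intros continuous_on_compose2[OF cont]) auto
  then have "S (\<bar>t\<bar> * x) - \<bar>t\<bar> * S x = 0"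
    using continuous_constant_on_closure[of \<rat> "\<lambda>q. S (\<bar>q\<bar> * x) - \<bar>q\<bar> * S x" 0 t] rat
    by (simp add: Rats_closure_real)
  then show ?thesis using \<open>t \<ge> 0\<close> by simp
qed

lemma weak_heiberg_seneta_bounded_above:
  assumes sub: "subadditive_fun S" and whs: "weak_heiberg_seneta S"
  obtains U z M where "open U" "z \<in> U" "\<And>u. u \<in> U \<Longrightarrow> S u \<le> M"
proof -
  obtain \<Sigma> where pos: "\<Sigma> \<subseteq> {0<..}" and sw: "locally_steinhaus_weil \<Sigma>"
    and acc: "0 islimpt \<Sigma>" and fin: "gamma_coeff \<Sigma> S < \<infinity>"
    using whs unfolding weak_heiberg_seneta_def by blast
  obtain n :: nat where "gamma_coeff \<Sigma> S < ereal (real n)"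
    using fin less_PInf_Ex_of_nat[of "gamma_coeff \<Sigma> S"] by auto
  then have "\<forall>\<^sub>F t in at 0 within (\<Sigma> \<inter> {0<..}). ereal (S t / t) < ereal (real n)"
    unfolding gamma_coeff_def by (rule Limsup_lessD)
  then obtain d where "d > 0" and "\<And>t. \<lbrakk>t \<in> \<Sigma>; 0 < t; t < d\<rbrakk> \<Longrightarrow> S t / t < real n"
    by (auto simp: eventually_at)
  then have bound: "S t \<le> real n * d" if "t \<in> \<Sigma>" "t < d" for t
  proof -
    have "0 < t" using pos that by auto
    then have "S t \<le> real n * t"
      using \<open>\<And>t. \<lbrakk>t \<in> \<Sigma>; 0 < t; t < d\<rbrakk> \<Longrightarrow> S t / t < real n\<close>[of t] that by (simp add: field_simps)
    also have "\<dots> \<le> real n * d" using that by (intro mult_left_mono) auto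
    finally show ?thesis .
  qed
  \<comment> \<open>The Steinhaus-Weil property is applied to the pair \<open>x\<close>,
    \<open>x\<close>. Taking \<open>x < d\<close> leaves room for a radius
    \<open>\<delta> < d - x\<close>, which keeps both summands in the range of
    \<open>bound\<close>.\<close>
  obtain x where x: "x \<in> \<Sigma>" "x < d"
    using acc \<open>d > 0\<close> by (force simp: islimpt_approachable dist_real_def)
  define P where "P \<delta> = {a + b | a b. a \<in> local_part \<Sigma> \<delta> x \<and> b \<in> local_part \<Sigma> \<delta> x}" for \<delta>
  have "\<forall>\<^sub>F \<delta> in at_right 0. x + x \<in> interior (P \<delta>)"
    using sw x(1) unfolding locally_steinhaus_weil_def P_def
    by (auto elim!: eventually_mono dest!: bspec)
  moreover have "\<forall>\<^sub>F \<delta> in at_right 0. \<delta> < d - x"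
    using x by (intro eventually_at_right_real[THEN eventually_mono]) auto
  ultimately have "\<forall>\<^sub>F \<delta> in at_right 0. x + x \<in> interior (P \<delta>) \<and> \<delta> < d - x"
    by (rule eventually_conj)
  then obtain \<delta> where \<delta>: "x + x \<in> interior (P \<delta>)" "\<delta> < d - x"
    using eventually_happens'[OF trivial_limit_at_right_real] by blast
  have "S u \<le> 2 * (real n * d)" if "u \<in> interior (P \<delta>)" for u
  proof -
    have "u \<in> P \<delta>" using that interior_subset by blast
    then obtain a b where u: "u = a + b" and ab: "a \<in> \<Sigma>" "a < d" "b \<in> \<Sigma>" "b < d"
      using \<delta>(2) by (auto simp: P_def local_part_def)
    have "S u \<le> S a + S b"
      using sub u by (simp add: subadditive_fun_def)
    then show ?thesis using bound[of a] bound[of b] ab by simp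
  qed
  with open_interior \<delta>(1) show ?thesis by (rule that)
qed

theorem theorem5:
  fixes S :: "real \<Rightarrow> real" and A :: "real set"
  assumes regular: "locally_bounded_fun S \<or> baire_property_fun S \<or> S \<in> borel_measurable lebesgue"
    and sublinear: "sublinear_fun S"
    and zero: "S 0 = 0"
    and WHS: "weak_heiberg_seneta S"
    and subgroup: "additive_subgroup_real A"
    and dense: "closure A = UNIV"
    and homogeneous: "nat_homogeneous_on A S"
  shows "linear_fun_on {0..} S \<and> linear_fun_on {..0} S \<and>
         (\<forall>t\<ge>0. S t = beta_coeff S * t \<and> S (- t) = - alpha_coeff S * t) \<and>
         (Modules.additive S \<longrightarrow> (\<forall>t. S t = beta_coeff S * t))"
proof -
  have sub: "subadditive_fun S"
    using sublinear by (simp add: sublinear_fun_def)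
  obtain U z M where "open U" "z \<in> U" "\<And>u. u \<in> U \<Longrightarrow> S u \<le> M"
    using weak_heiberg_seneta_bounded_above[OF sub WHS] by metis
  with sub obtain r K where "r > 0" "\<And>h. \<bar>h\<bar> < r \<Longrightarrow> S h \<le> K"
    using subadditive_bounded_above_near_0 by metis
  with sublinear have "continuous_on UNIV S"
    by (rule sublinear_continuous)
  with sublinear have hom: "S (t * x) = t * S x" if "t \<ge> 0" for t x
    using that by (rule continuous_sublinear_homogeneous)
  \<comment> \<open>The quotients are constant on each half-line, so the infimum and the supremum
    are just their values at \<open>1\<close> and \<open>- 1\<close>.\<close>
  have "S t / t = S 1" if "t > 0" for t
    using hom[of t 1] that by simp
  then have "(INF t\<in>{0<..}. S t / t) = (INF t\<in>{0::real<..}. S 1)"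
    by (intro INF_cong) auto
  then have beta: "beta_coeff S = S 1"
    by (simp add: beta_coeff_def)
  have "S z / z = - S (- 1)" if "z < 0" for z
    using hom[of "- z" "- 1"] that by simp
  then have "(SUP z\<in>{..<0}. S z / z) = (SUP z\<in>{..<0::real}. - S (- 1))"
    by (intro SUP_cong) auto
  then have alpha: "alpha_coeff S = - S (- 1)"
    by (simp add: alpha_coeff_def)
  have half: "S t = beta_coeff S * t \<and> S (- t) = - alpha_coeff S * t" if "t \<ge> 0" for t
    using hom[OF that, of 1] hom[OF that, of "- 1"] by (simp add: alpha beta)
  then have right: "linear_fun_on {0..} S"
    unfolding linear_fun_on_def by (intro exI[of _ "beta_coeff S"]) auto
  have "S x = alpha_coeff S * x" if "x \<le> 0" for x
    using half[of "- x"] that by simp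
  then have left: "linear_fun_on {..0} S"
    unfolding linear_fun_on_def by (intro exI[of _ "alpha_coeff S"]) auto
  have "S t = beta_coeff S * t" if "Modules.additive S" for t
  proof (cases "t \<ge> 0")
    case True
    then show ?thesis using half by blast
  next
    \<comment> \<open>An additive function is odd, so the formula on the positive half-line
      transfers to negative \<open>t\<close> with the same slope.\<close>
    case False
    then show ?thesis
      using half[of "- t"] additive.minus[OF that, of t] by simp
  qed
  with half left right show ?thesis by blast
qed

end
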